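(* In the dynamic congestion game on the parallel network described in the context, under the myopic policy with exploration number $n_i^{(m)}(t)$ on stochastic path $i$, the learned hazard belief $x_i(t)$ is not guaranteed to converge, as $t\to\infty$, to its real steady state $\bar x$ (the long-run expected probability that $\alpha_i(t)=\alpha_H$).
   Context: Setting (parallel network). Time is $t\in\{0,1,\dots\}$. In slot $t$ a random number $N(t)\in[N_{min},N_{max}]$ of atomic users, with $\mathbb{E}[N(t)]=\bar N$, arrives at origin O; each chooses one of $M+1$ parallel paths to destination D: safe path $0$ with fixed latency $\ell_0$, or a stochastic path $i\in\mathcal{M}=\{1,\dots,M\}$ with latency $\ell_i(t)$. Let $n_i(t)$ be the number of users on path $i$ in slot $t$, $\sum_{i=0}^M n_i(t)=N(t)$. Latencies evolve by $\ell_i(t+1)=f(\ell_i(t),n_i(t),\alpha_i(t))$ with $f$ increasing in each argument, where $\alpha_i(t)\in\{\alpha_H,\alpha_L\}$ (high/low hazard) follows a memoryless stochastic process, $\alpha_H\in[1,\infty)$, $\alpha_L\in[0,1)$. The long-run expected probability that $\alpha_i(t)=\alpha_H$ is $\bar x$, so the expected steady state is $\mathbb{E}[\alpha_i(t)|\bar x]=\bar x\alpha_H+(1-\bar x)\alpha_L$; users do not know $\bar x$ but know its distribution $\mathbb{P}(\bar x)$. Learning. The users on path $i$ produce a fused observation $y_i(t)\in\{0,1,\emptyset\}$ ($1$: hazard; $0$: no hazard; $\emptyset$ iff $n_i(t)=0$), with $q_H(n)=\Pr(y_i(t)=1\mid\alpha_i(t)=\alpha_H,n_i(t)=n)$ increasing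 in $n$ and $q_L(n)=\Pr(y_i(t)=1\mid\alpha_i(t)=\alpha_L,n_i(t)=n)$ decreasing in $n$. The prior hazard belief $x_i(t)$ is updated to the posterior $x_i'(t)=\frac{x_iq_H(n_i)}{x_iq_H(n_i)+(1-x_i)q_L(n_i)}$ if $y_i(t)=1$, $x_i'(t)=\frac{x_i(1-q_H(n_i))}{x_i(1-q_H(n_i))+(1-x_i)(1-q_L(n_i))}$ if $y_i(t)=0$, $x_i'(t)=x_i(t)$ if $y_i(t)=\emptyset$ (with $x_i=x_i(t)$, $n_i=n_i(t)$), and $x_i(t+1)=x_i'(t)$. Expected latency is updated by $\mathbb{E}[\ell_i(t+1)|x_i'(t)]=\mathbb{E}\big[f(\mathbb{E}[\ell_i(t)|x_i'(t-1)],n_i(t),\alpha_i(t))\big]$, with $\alpha_i(t)=\alpha_H$ with probability $x_i'(t)$ and $\alpha_L$ otherwise. Costs. A user's cost is $c_0(n_0(t))=\ell_0+n_0(t)$ on path $0$ and $c_i(n_i(t))=\mathbb{E}[\ell_i(t)|x_i'(t-1)]+n_i(t)+V(n_i(t-1))$ on path $i\in\mathcal{M}$, where the variance cost $V(\cdot)$ is a decreasing function. Myopic policy: each user is sent to the path minimizing his own current cost, so the allocation $n_i^{(m)}(t)$ is the one-slot equilibrium (used paths have equal cost, unused paths have no smaller cost). "Not guaranteed" means that there are instances of the system for which convergence to $\bar x$ fails. *)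

theory Defs
  imports "HOL-Probability.Probability"
begin

datatype observation = Hazard | No_Hazard | No_Report

text \<open>
  A network together with one run of the game on it. Path \<open>0\<close> is the safe path, paths
  \<open>1, \<dots>, num_paths\<close> are the stochastic ones. Per-path processes take the path, the time slot and
  the sample point, in this order. The constant \<open>xbar\<close> is the realised value of the long-run
  hazard probability; \<open>prior\<close> is its distribution as known to the users. \<open>init_count i\<close> stands
  for the number of users on path \<open>i\<close> in the slot preceding slot \<open>0\<close>.
\<close>

record 'w network =
  prob_sp :: "'w measure"
  num_paths :: nat
  n_min :: nat
  n_max :: nat
  mean_arrivals :: real
  safe_latency :: real
  latency_map :: "real \<Rightarrow> nat \<Rightarrow> real \<Rightarrow> real"
  alpha_H :: real
  alpha_L :: real
  q_H :: "nat \<Rightarrow> real"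
  q_L :: "nat \<Rightarrow> real"
  variance_cost :: "nat \<Rightarrow> real"
  xbar :: real
  prior :: "real measure"
  init_latency :: "nat \<Rightarrow> real"
  init_count :: "nat \<Rightarrow> nat"
  arrivals :: "nat \<Rightarrow> 'w \<Rightarrow> nat"
  hazard :: "nat \<Rightarrow> nat \<Rightarrow> 'w \<Rightarrow> real"
  users :: "nat \<Rightarrow> nat \<Rightarrow> 'w \<Rightarrow> nat"
  obs :: "nat \<Rightarrow> nat \<Rightarrow> 'w \<Rightarrow> observation"
  latency :: "nat \<Rightarrow> nat \<Rightarrow> 'w \<Rightarrow> real"

definition posterior :: "'w network \<Rightarrow> nat \<Rightarrow> observation \<Rightarrow> real \<Rightarrow> real" where
  "posterior S n y x =
     (case y of
        Hazard \<Rightarrow> x * q_H S n / (x * q_H S n + (1 - x) * q_L S n)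
      | No_Hazard \<Rightarrow> x * (1 - q_H S n) / (x * (1 - q_H S n) + (1 - x) * (1 - q_L S n))
      | No_Report \<Rightarrow> x)"

text \<open>
  \<open>belief S i t\<close> is the belief held on path \<open>i\<close> at the beginning of slot \<open>t\<close>, so
  \<open>belief S i (Suc t)\<close> is also the posterior formed in slot \<open>t\<close>. The first belief is the hazard
  probability induced by the users' knowledge of the distribution of \<open>xbar\<close>, i.e. its mean.
\<close>

primrec belief :: "'w network \<Rightarrow> nat \<Rightarrow> nat \<Rightarrow> 'w \<Rightarrow> real" where
  "belief S i 0 \<omega> = (\<integral>x. x \<partial>prior S)"
| "belief S i (Suc t) \<omega> = posterior S (users S i t \<omega>) (obs S i t \<omega>) (belief S i t \<omega>)"

text \<open>\<open>expected_latency S i t\<close> is the estimate of the latency in slot \<open>t\<close> given the posterior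
  formed in slot \<open>t - 1\<close>.\<close>

primrec expected_latency :: "'w network \<Rightarrow> nat \<Rightarrow> nat \<Rightarrow> 'w \<Rightarrow> real" where
  "expected_latency S i 0 \<omega> = init_latency S i"
| "expected_latency S i (Suc t) \<omega> =
     belief S i (Suc t) \<omega> *
       latency_map S (expected_latency S i t \<omega>) (users S i t \<omega>) (alpha_H S) +
     (1 - belief S i (Suc t) \<omega>) *
       latency_map S (expected_latency S i t \<omega>) (users S i t \<omega>) (alpha_L S)"

definition previous_users :: "'w network \<Rightarrow> nat \<Rightarrow> nat \<Rightarrow> 'w \<Rightarrow> nat" where
  "previous_users S i t \<omega> = (case t of 0 \<Rightarrow> init_count S i | Suc s \<Rightarrow> users S i s \<omega>)"

definition cost :: "'w network \<Rightarrow> nat \<Rightarrow> nat \<Rightarrow> 'w \<Rightarrow> real" where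
  "cost S i t \<omega> =
     (if i = 0 then safe_latency S + real (users S 0 t \<omega>)
      else expected_latency S i t \<omega> + real (users S i t \<omega>)
             + variance_cost S (previous_users S i t \<omega>))"

text \<open>The events determined by the arrivals up to slot \<open>t\<close> and by the hazard states and
  observations of all earlier slots.\<close>

definition history :: "'w network \<Rightarrow> nat \<Rightarrow> 'w set set" where
  "history S t = sigma_sets (space (prob_sp S))
     ({arrivals S s -` B \<inter> space (prob_sp S) | s B. s \<le> t} \<union>
      {hazard S j s -` B \<inter> space (prob_sp S) | j s B.
         j \<in> {1..num_paths S} \<and> s < t \<and> B \<in> sets borel} \<union>
      {obs S j s -` B \<inter> space (prob_sp S) | j s B. j \<in> {1..num_paths S} \<and> s < t})"

definition valid_parameters :: "'w network \<Rightarrow> bool" where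
  "valid_parameters S \<longleftrightarrow>
     1 \<le> num_paths S \<and> 1 \<le> n_min S \<and> n_min S \<le> n_max S \<and>
     1 \<le> alpha_H S \<and> 0 \<le> alpha_L S \<and> alpha_L S < 1 \<and>
     0 \<le> safe_latency S \<and> (\<forall>i\<in>{1..num_paths S}. 0 \<le> init_latency S i) \<and>
     (\<forall>l n a. 0 \<le> l \<longrightarrow> 0 \<le> a \<longrightarrow> 0 \<le> latency_map S l n a) \<and>
     (\<forall>n a. 0 \<le> a \<longrightarrow> strict_mono_on {0..} (\<lambda>l. latency_map S l n a)) \<and>
     (\<forall>l a. 0 \<le> l \<longrightarrow> 0 \<le> a \<longrightarrow> strict_mono (\<lambda>n. latency_map S l n a)) \<and>
     (\<forall>l n. 0 \<le> l \<longrightarrow> strict_mono_on {0..} (\<lambda>a. latency_map S l n a)) \<and>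
     strict_mono_on {1..} (q_H S) \<and> strict_antimono_on {1..} (q_L S) \<and>
     (\<forall>n\<ge>1. q_H S n \<in> {0..1} \<and> q_L S n \<in> {0..1}) \<and>
     strict_antimono_on UNIV (variance_cost S) \<and> (\<forall>n. 0 \<le> variance_cost S n) \<and>
     prob_space (prior S) \<and> sets (prior S) = sets borel \<and>
     (AE x in prior S. x \<in> {0..1}) \<and>
     xbar S \<in> {0..1} \<and> (\<forall>e>0. measure (prior S) (ball (xbar S) e) > 0)"

text \<open>The condition on \<open>ball (xbar S) e\<close> above says that the realised \<open>xbar\<close> lies in the support
  of its distribution.\<close>

definition arrival_process :: "'w network \<Rightarrow> bool" where
  "arrival_process S \<longleftrightarrow>
     (\<forall>t. arrivals S t \<in> measurable (prob_sp S) (count_space UNIV) \<and>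
          (\<forall>\<omega>\<in>space (prob_sp S). arrivals S t \<omega> \<in> {n_min S..n_max S}) \<and>
          (\<integral>\<omega>. real (arrivals S t \<omega>) \<partial>prob_sp S) = mean_arrivals S)"

text \<open>Memorylessness is independence of the past. The hazard process is taken to be in its steady
  state, hence its expectation is \<open>xbar * alpha_H + (1 - xbar) * alpha_L\<close> in every slot.\<close>

definition hazard_process :: "'w network \<Rightarrow> bool" where
  "hazard_process S \<longleftrightarrow>
     (\<forall>i\<in>{1..num_paths S}. \<forall>t.
        hazard S i t \<in> borel_measurable (prob_sp S) \<and>
        (\<forall>\<omega>\<in>space (prob_sp S). hazard S i t \<omega> \<in> {alpha_H S, alpha_L S}) \<and>
        \<P>(\<omega> in prob_sp S. hazard S i t \<omega> = alpha_H S) = xbar S \<and>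
        prob_space.indep_set (prob_sp S) (history S t)
          {hazard S i t -` B \<inter> space (prob_sp S) | B. B \<in> sets borel})"

definition allocation :: "'w network \<Rightarrow> bool" where
  "allocation S \<longleftrightarrow>
     (\<forall>i\<le>num_paths S. \<forall>t. users S i t \<in> measurable (prob_sp S) (count_space UNIV)) \<and>
     (\<forall>t. \<forall>\<omega>\<in>space (prob_sp S). (\<Sum>i\<le>num_paths S. users S i t \<omega>) = arrivals S t \<omega>)"

text \<open>The observation probabilities hold conditionally on any past event \<open>A\<close>; \<open>A\<close> being the whole
  space gives the unconditional version.\<close>

definition observation_process :: "'w network \<Rightarrow> bool" where
  "observation_process S \<longleftrightarrow>
     (\<forall>i\<in>{1..num_paths S}. \<forall>t.
        obs S i t \<in> measurable (prob_sp S) (count_space UNIV) \<and>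
        (\<forall>\<omega>\<in>space (prob_sp S). obs S i t \<omega> = No_Report \<longleftrightarrow> users S i t \<omega> = 0) \<and>
        (\<forall>A\<in>history S t. \<forall>n\<ge>1.
          (\<P>(\<omega> in prob_sp S. \<omega> \<in> A \<and> hazard S i t \<omega> = alpha_H S \<and> users S i t \<omega> = n) > 0 \<longrightarrow>
           \<P>(\<omega> in prob_sp S. obs S i t \<omega> = Hazard \<bar>
             \<omega> \<in> A \<and> hazard S i t \<omega> = alpha_H S \<and> users S i t \<omega> = n) = q_H S n) \<and>
          (\<P>(\<omega> in prob_sp S. \<omega> \<in> A \<and> hazard S i t \<omega> = alpha_L S \<and> users S i t \<omega> = n) > 0 \<longrightarrow>
           \<P>(\<omega> in prob_sp S. obs S i t \<omega> = Hazard \<bar>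
             \<omega> \<in> A \<and> hazard S i t \<omega> = alpha_L S \<and> users S i t \<omega> = n) = q_L S n)))"

definition latency_process :: "'w network \<Rightarrow> bool" where
  "latency_process S \<longleftrightarrow>
     (\<forall>i\<in>{1..num_paths S}. \<forall>\<omega>\<in>space (prob_sp S).
        latency S i 0 \<omega> = init_latency S i \<and>
        (\<forall>t. latency S i (Suc t) \<omega> =
               latency_map S (latency S i t \<omega>) (users S i t \<omega>) (hazard S i t \<omega>)))"

definition congestion_game :: "'w network \<Rightarrow> bool" where
  "congestion_game S \<longleftrightarrow>
     prob_space (prob_sp S) \<and> valid_parameters S \<and> arrival_process S \<and> hazard_process S \<and>
     allocation S \<and> observation_process S \<and> latency_process S"

definition myopic_policy :: "'w network \<Rightarrow> bool" where
  "myopic_policy S \<longleftrightarrow>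
     (\<forall>t. \<forall>\<omega>\<in>space (prob_sp S). \<forall>i\<le>num_paths S. \<forall>j\<le>num_paths S.
        users S i t \<omega> > 0 \<longrightarrow>
          (users S j t \<omega> > 0 \<longrightarrow> cost S i t \<omega> = cost S j t \<omega>) \<and>
          (users S j t \<omega> = 0 \<longrightarrow> cost S i t \<omega> \<le> cost S j t \<omega>))"

text \<open>Convergence in probability. Almost sure convergence and convergence in mean both imply it,
  so where it fails they fail as well.\<close>

definition belief_converges :: "'w network \<Rightarrow> nat \<Rightarrow> bool" where
  "belief_converges S i \<longleftrightarrow>
     (\<forall>e>0. (\<lambda>t. \<P>(\<omega> in prob_sp S. \<bar>belief S i t \<omega> - xbar S\<bar> \<ge> e)) \<longlonglongrightarrow> 0)"

end

theory Submission
  imports Defs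
begin

text \<open>
  If the initial latency estimate of every stochastic path exceeds the cost of the safe path, myopic
  users never leave the safe path. No observation is ever made, so the belief stays at the prior
  mean. It then suffices that the realised \<open>xbar\<close> lies in the support of the prior without being
  its mean: take \<open>xbar = 1\<close> under the fair-coin prior on \<open>{0, 1}\<close>.
\<close>

definition coin_prior :: "real measure" where
  "coin_prior = distr (measure_pmf (bernoulli_pmf (1 / 2))) borel of_bool"

lemma prob_space_coin_prior: "prob_space coin_prior"
  unfolding coin_prior_def by (rule measure_pmf.prob_space_distr) simp

lemma sets_coin_prior: "sets coin_prior = sets borel"
  by (simp add: coin_prior_def)

lemma AE_coin_prior: "AE x in coin_prior. x \<in> {0..1}"
  unfolding coin_prior_def by (subst AE_distr_iff) auto

lemma mean_coin_prior: "(\<integral>x. x \<partial>coin_prior) = 1 / 2"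
  unfolding coin_prior_def by (subst integral_distr) auto

text \<open>The point \<open>1\<close> is an atom of mass \<open>1 / 2\<close>, so it lies in the
  support of the prior; this makes \<open>xbar = 1\<close> admissible.\<close>

lemma coin_prior_ball_one:
  assumes "e > 0"
  shows "measure coin_prior (ball 1 e) > 0"
proof -
  have "0 < measure (measure_pmf (bernoulli_pmf (1 / 2))) {True}"
    by (simp add: measure_pmf_single)
  also have "\<dots> \<le> measure (measure_pmf (bernoulli_pmf (1 / 2))) (of_bool -` ball (1 :: real) e)"
    using assms by (intro measure_pmf.finite_measure_mono) auto
  also have "\<dots> = measure coin_prior (ball 1 e)"
    by (simp add: coin_prior_def measure_distr)
  finally show ?thesis .
qed

text \<open>A point mass makes every process deterministic. The constant hazard \<open>1\<close> is
  \<open>alpha_H\<close>, in agreement with \<open>xbar = 1\<close>. The initial estimate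
  \<open>1\<close> equals the cost that the single user pays on the safe path, and the variance cost
  comes on top of it.\<close>

definition unexplored_network :: "nat \<Rightarrow> 'w network" where
  "unexplored_network M =
     \<lparr>prob_sp = return (count_space UNIV) undefined,
      num_paths = M,
      n_min = 1,
      n_max = 1,
      mean_arrivals = 1,
      safe_latency = 0,
      latency_map = (\<lambda>l n a. l + real n + a),
      alpha_H = 1,
      alpha_L = 0,
      q_H = (\<lambda>n. 1 - 1 / (real n + 1)),
      q_L = (\<lambda>n. 1 / (real n + 1)),
      variance_cost = (\<lambda>n. 1 / (real n + 1)),
      xbar = 1,
      prior = coin_prior,
      init_latency = (\<lambda>_. 1),
      init_count = (\<lambda>_. 0),
      arrivals = (\<lambda>_ _. 1),
      hazard = (\<lambda>_ _ _. 1),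
      users = (\<lambda>i _ _. of_bool (i = 0)),
      obs = (\<lambda>i _ _. if i = 0 then Hazard else No_Report),
      latency = (\<lambda>i t _. 1 + (real (of_bool (i = 0)) + 1) * real t)\<rparr>"

lemma prob_space_unexplored: "prob_space (prob_sp (unexplored_network M))"
  by (simp add: unexplored_network_def prob_space_return)

lemma valid_parameters_unexplored:
  assumes "1 \<le> M"
  shows "valid_parameters (unexplored_network M)"
proof -
  have prior: "prior (unexplored_network M) = coin_prior"
    by (simp add: unexplored_network_def)
  show ?thesis
    unfolding valid_parameters_def prior
    using assms AE_coin_prior
    by (auto simp: unexplored_network_def monotone_on_def
        prob_space_coin_prior sets_coin_prior coin_prior_ball_one field_simps)
qed

lemma arrival_process_unexplored: "arrival_process (unexplored_network M)"
  by (simp add: arrival_process_def unexplored_network_def measure_return)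

text \<open>Under a point mass the probability of an event is its indicator at \<open>w\<close>, and
  the indicator of an intersection is the product of the indicators.\<close>

lemma indep_set_return_count_space:
  "prob_space.indep_set (return (count_space UNIV) w) \<A> \<B>"
proof -
  interpret prob_space "return (count_space UNIV) w"
    by (simp add: prob_space_return)
  show ?thesis
    by (rule indep_setI) (auto simp: measure_return indicator_def)
qed

lemma hazard_process_unexplored: "hazard_process (unexplored_network M)"
  by (simp add: hazard_process_def unexplored_network_def indep_set_return_count_space measure_return)

lemma allocation_unexplored: "allocation (unexplored_network M)"
  by (simp add: allocation_def unexplored_network_def)

text \<open>On a stochastic path no slot has \<open>n \<ge> 1\<close> users, so the conditioning
  events are null and both conditional laws hold vacuously.\<close>

lemma observation_process_unexplored: "observation_process (unexplored_network M)"
  by (auto simp: observation_process_def unexplored_network_def)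

lemma latency_process_unexplored: "latency_process (unexplored_network M)"
  by (simp add: latency_process_def unexplored_network_def algebra_simps)

lemma congestion_game_unexplored:
  assumes "1 \<le> M"
  shows "congestion_game (unexplored_network M)"
  using assms
  by (simp add: congestion_game_def prob_space_unexplored valid_parameters_unexplored
      arrival_process_unexplored hazard_process_unexplored allocation_unexplored
      observation_process_unexplored latency_process_unexplored)

text \<open>Every slot yields \<open>No_Report\<close>, which leaves the initial belief, the prior
  mean, untouched.\<close>

lemma belief_unexplored:
  assumes "i \<noteq> 0"
  shows "belief (unexplored_network M) i t \<omega> = 1 / 2"
  using assms
  by (induction t) (simp_all add: unexplored_network_def posterior_def mean_coin_prior)

lemma expected_latency_unexplored:
  assumes "i \<noteq> 0"
  shows "1 \<le> expected_latency (unexplored_network M) i t \<omega>"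
proof (induction t)
  case 0
  show ?case by (simp add: unexplored_network_def)
next
  case (Suc t)
  \<comment> \<open>Without users the latency map adds only the hazard value, and the belief
    \<open>1 / 2\<close> averages \<open>alpha_H = 1\<close> and \<open>alpha_L = 0\<close>.\<close>
  have "expected_latency (unexplored_network M) i (Suc t) \<omega> =
      expected_latency (unexplored_network M) i t \<omega> + 1 / 2"
    unfolding expected_latency.simps belief_unexplored[OF assms]
    using assms by (simp add: unexplored_network_def field_simps)
  with Suc show ?case by simp
qed

lemma users_unexplored: "users (unexplored_network M) i t \<omega> = of_bool (i = 0)"
  by (simp add: unexplored_network_def)

lemma cost_unexplored_safe: "cost (unexplored_network M) 0 t \<omega> = 1"
  by (simp add: cost_def unexplored_network_def)

lemma cost_unexplored_stochastic:
  assumes "j \<noteq> 0"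
  shows "1 \<le> cost (unexplored_network M) j t (\<omega> :: 'a)"
proof -
  let ?S = "unexplored_network M :: 'a network"
  have "0 \<le> variance_cost ?S (previous_users ?S j t \<omega>)"
    by (simp add: unexplored_network_def)
  with assms expected_latency_unexplored[OF assms, of M t \<omega>] show ?thesis
    by (simp add: cost_def users_unexplored)
qed

text \<open>Only path \<open>0\<close> is used, so the equilibrium condition reduces to comparing
  its cost \<open>1\<close> with the stochastic costs, all at least \<open>1\<close>.\<close>

lemma myopic_policy_unexplored: "myopic_policy (unexplored_network M)"
  by (auto simp: myopic_policy_def users_unexplored cost_unexplored_safe cost_unexplored_stochastic)

lemma not_belief_converges_unexplored:
  assumes "i \<noteq> 0"
  shows "\<not> belief_converges (unexplored_network M :: 'w network) i"
proof
  let ?S = "unexplored_network M :: 'w network"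
  interpret prob_space "prob_sp ?S" by (rule prob_space_unexplored)
  have gap: "\<bar>belief ?S i t \<omega> - xbar ?S\<bar> = 1 / 2" for t \<omega>
    by (simp add: belief_unexplored[OF assms]) (simp add: unexplored_network_def)
  assume "belief_converges ?S i"
  \<comment> \<open>At the threshold \<open>1 / 2\<close>, the exact gap, the event is the whole
    space, so the sequence is constantly \<open>1\<close>.\<close>
  then have "(\<lambda>t. \<P>(\<omega> in prob_sp ?S. \<bar>belief ?S i t \<omega> - xbar ?S\<bar> \<ge> 1 / 2)) \<longlonglongrightarrow> 0"
    unfolding belief_converges_def by (elim allE[of _ "1 / 2"]) simp
  then show False
    by (simp add: gap prob_space LIMSEQ_const_iff)
qed

theorem lemma4:
  fixes M i :: nat
  assumes "i \<in> {1..M}"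
  shows "\<exists>S :: (nat \<Rightarrow> real) network.
           num_paths S = M \<and> congestion_game S \<and> myopic_policy S \<and> \<not> belief_converges S i"
proof (intro exI conjI)
  show "num_paths (unexplored_network M) = M"
    by (simp add: unexplored_network_def)
  show "congestion_game (unexplored_network M)"
    using assms by (intro congestion_game_unexplored) simp
  show "myopic_policy (unexplored_network M)"
    by (rule myopic_policy_unexplored)
  show "\<not> belief_converges (unexplored_network M) i"
    using assms by (intro not_belief_converges_unexplored) simp
qed

end
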